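(* Fix $d\geq1$ and let $N$ range over an unbounded set of moduli. Suppose $S_N\subseteq\mathbb Z_N^d$ are nonempty sets with $|S_N|=N^{\alpha+o(1)}$, where $0<\alpha<d$, and let $f_N\neq0$ be functions $\mathbb Z_N^d\to\mathbb C$ supported on $S_N$. Set $$\kappa_f=\kappa(\{f_N\}),\qquad \kappa_S=\kappa(\{1_{S_N}\}),\qquad \kappa=\max\{\kappa_f,\kappa_S\}.$$ (1) For every fixed $2\leq p<\infty$ and $\varepsilon>0$, all sufficiently large $N$ satisfy $$\|\widehat f_N\|_\infty\leq N^{\frac{\alpha-d}{2}+\left(\frac{d}{2}-\kappa\right)\left(1-\frac{2}{p}\right)+\varepsilon}\,\|\widehat f_N\|_p .$$ (2) If $\kappa<\frac{\alpha}{2}$, then $\sup_N\|\widehat f_N\|_p<\infty$ implies $\|\widehat f_N\|_\infty\to0$ whenever $$2\leq p<\frac{2(d-2\kappa)}{\alpha-2\kappa}.$$ (3) If $\kappa=\frac{\alpha}{2}$, then $\sup_N\|\widehat f_N\|_p<\infty$ implies $\|\widehat f_N\|_\infty\to0$ for every finite $p\geq2$. (4) Each of the conclusions (1)–(3) also holds with $\kappa$ replaced by $\kappa_f$ alone, or by $\kappa_S$ alone. When $\kappa_S$ alone is used, the conclusion is uniform over all functions supported on $S_N$ (in (1), the threshold for $N$ can be chosen depending only on the family $\{S_N\}$, $p$ and $\varepsilon$, and not on the functions).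
   Context: $N\ge 2$, $\mathbb Z_N=\mathbb Z/N\mathbb Z$; a family may be indexed by any unbounded set of moduli $N$, and all limits, liminf and limsup as $N\to\infty$ are taken within that set; $d$ is fixed. For $f:\mathbb Z_N^d\to\mathbb C$ the unitary Fourier transform is $\widehat f(\xi)=N^{-d/2}\sum_{x\in\mathbb Z_N^d}f(x)e^{-2\pi i x\cdot\xi/N}$. All norms use counting measure: $\|f\|_r=(\sum_x|f(x)|^r)^{1/r}$, $\|f\|_\infty=\max_x|f(x)|$. $1_S$ is the indicator of $S$. For $f\neq0$, $\operatorname{FR}(f)=\|\widehat f\|_1/\|\widehat f\|_2$ and $\kappa_N(f)=\log\bigl(N^{d/2}/\operatorname{FR}(f)\bigr)/\log N$. For a sequence of nonzero functions $f_N$ on $\mathbb Z_N^d$, $\kappa(\{f_N\})=\liminf_{N\to\infty}\kappa_N(f_N)$. The notation $|S_N|=N^{\alpha+o(1)}$ means $\log|S_N|/\log N\to\alpha$. *)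

theory Defs
  imports "HOL-Analysis.Analysis"
begin

text \<open>
  Elements of the group of d-tuples of residues mod N are represented by their least nonnegative
  representatives, as extensional functions on the index set. Only the values of a function
  \<open>f :: (nat \<Rightarrow> nat) \<Rightarrow> complex\<close> on \<open>ZNd d N\<close> are relevant.
\<close>

definition ZNd :: "nat \<Rightarrow> nat \<Rightarrow> (nat \<Rightarrow> nat) set" where
  "ZNd d N = {..<d} \<rightarrow>\<^sub>E {..<N}"

definition fourier :: "nat \<Rightarrow> nat \<Rightarrow> ((nat \<Rightarrow> nat) \<Rightarrow> complex) \<Rightarrow> (nat \<Rightarrow> nat) \<Rightarrow> complex" where
  "fourier d N f \<xi> = of_real (real N powr (- (real d / 2))) *
     (\<Sum>x\<in>ZNd d N. f x * exp (- 2 * of_real pi * \<i> * of_nat (\<Sum>i<d. x i * \<xi> i) / of_nat N))"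

definition lp_norm :: "nat \<Rightarrow> nat \<Rightarrow> real \<Rightarrow> ((nat \<Rightarrow> nat) \<Rightarrow> complex) \<Rightarrow> real" where
  "lp_norm d N r f = (\<Sum>x\<in>ZNd d N. norm (f x) powr r) powr (1 / r)"

definition sup_norm :: "nat \<Rightarrow> nat \<Rightarrow> ((nat \<Rightarrow> nat) \<Rightarrow> complex) \<Rightarrow> real" where
  "sup_norm d N f = Max ((\<lambda>x. norm (f x)) ` ZNd d N)"

definition nonzero_on :: "nat \<Rightarrow> nat \<Rightarrow> ((nat \<Rightarrow> nat) \<Rightarrow> complex) \<Rightarrow> bool" where
  "nonzero_on d N f \<longleftrightarrow> (\<exists>x\<in>ZNd d N. f x \<noteq> 0)"

definition supported_on :: "nat \<Rightarrow> nat \<Rightarrow> (nat \<Rightarrow> nat) set \<Rightarrow> ((nat \<Rightarrow> nat) \<Rightarrow> complex) \<Rightarrow> bool" where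
  "supported_on d N S f \<longleftrightarrow> (\<forall>x\<in>ZNd d N - S. f x = 0)"

definition FR :: "nat \<Rightarrow> nat \<Rightarrow> ((nat \<Rightarrow> nat) \<Rightarrow> complex) \<Rightarrow> real" where
  "FR d N f = lp_norm d N 1 (fourier d N f) / lp_norm d N 2 (fourier d N f)"

definition kappa_at :: "nat \<Rightarrow> nat \<Rightarrow> ((nat \<Rightarrow> nat) \<Rightarrow> complex) \<Rightarrow> real" where
  "kappa_at d N f = ln (real N powr (real d / 2) / FR d N f) / ln (real N)"

text \<open>The filter of \<open>N \<rightarrow> \<infinity>\<close> within the set \<open>M\<close> of moduli.\<close>

definition moduli_at_top :: "nat set \<Rightarrow> nat filter" where
  "moduli_at_top M = inf sequentially (principal M)"

text \<open>
  The lower limit is taken in the complete lattice of extended reals; \<open>ereal_kappa\<close> below shows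
  that it is finite, so that the conversion back to the reals loses nothing.
\<close>

definition kappa :: "nat \<Rightarrow> nat set \<Rightarrow> (nat \<Rightarrow> (nat \<Rightarrow> nat) \<Rightarrow> complex) \<Rightarrow> real" where
  "kappa d M f = real_of_ereal (Liminf (moduli_at_top M) (\<lambda>N. ereal (kappa_at d N (f N))))"

lemma finite_ZNd: "finite (ZNd d N)"
  by (simp add: ZNd_def finite_PiE)

lemma card_ZNd: "card (ZNd d N) = N ^ d"
  by (simp add: ZNd_def card_PiE)

lemma lp_norm_1: "lp_norm d N 1 g = (\<Sum>x\<in>ZNd d N. norm (g x))"
  by (simp add: lp_norm_def sum_nonneg)

lemma lp_norm_2: "lp_norm d N 2 g = L2_set (\<lambda>x. norm (g x)) (ZNd d N)"
  by (simp add: lp_norm_def L2_set_def powr_half_sqrt sum_nonneg)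

lemma kappa_at_bounds:
  assumes "N \<ge> 2"
  shows "0 \<le> kappa_at d N f" and "kappa_at d N f \<le> real d / 2"
proof -
  define a b where "a = lp_norm d N 1 (fourier d N f)" and "b = lp_norm d N 2 (fourier d N f)"
  define T where "T = real N powr (real d / 2)"
  have N: "ln (real N) > 0" using assms by simp
  have T: "T > 0" using assms by (simp add: T_def)
  have lnT: "ln T = real d / 2 * ln (real N)" using assms by (simp add: T_def ln_powr)
  have ba: "b \<le> a"
    unfolding a_def b_def lp_norm_1 lp_norm_2 by (rule L2_set_le_sum) simp
  have b0: "b \<ge> 0" by (simp add: b_def lp_norm_2 L2_set_nonneg)
  have T': "T = L2_set (\<lambda>_. 1) (ZNd d N)"
    using assms by (simp add: T_def L2_set_def card_ZNd powr_half_sqrt[symmetric]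
        powr_realpow[symmetric] powr_powr)
  have aT: "a \<le> T * b"
    using L2_set_mult_ineq[of "\<lambda>_. 1::real" "\<lambda>x. norm (fourier d N f x)" "ZNd d N"]
    by (simp add: a_def b_def lp_norm_1 lp_norm_2 T')
  have "0 \<le> ln (T / (a / b)) \<and> ln (T / (a / b)) \<le> ln T"
  proof (cases "b = 0")
    case True
    have "ln T \<ge> 0" unfolding lnT using N by simp
    with True show ?thesis by simp
  next
    case False
    with b0 ba have "b > 0" "a > 0" by auto
    moreover have "T / (a / b) \<ge> 1" using aT \<open>a > 0\<close> \<open>b > 0\<close> by (simp add: field_simps)
    moreover have "T / (a / b) \<le> T" using ba \<open>a > 0\<close> \<open>b > 0\<close> T by (simp add: field_simps)
    ultimately show ?thesis using T by (metis ln_ge_zero ln_le_cancel_iff order_less_le_trans zero_less_one)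
  qed
  then show "0 \<le> kappa_at d N f" "kappa_at d N f \<le> real d / 2"
    using N lnT by (simp_all add: kappa_at_def FR_def a_def b_def T_def field_simps)
qed

lemma ereal_kappa:
  assumes "infinite M" and "\<forall>N\<in>M. N \<ge> 2"
  shows "ereal (kappa d M f) = Liminf (moduli_at_top M) (\<lambda>N. ereal (kappa_at d N (f N)))"
proof -
  let ?F = "moduli_at_top M" and ?k = "\<lambda>N. ereal (kappa_at d N (f N))"
  have nt: "?F \<noteq> bot"
    using assms(1) by (auto simp: moduli_at_top_def trivial_limit_def eventually_inf_principal
        eventually_sequentially infinite_nat_iff_unbounded_le)
  have ev: "\<forall>\<^sub>F N in ?F. N \<in> M"
    by (simp add: moduli_at_top_def eventually_inf_principal)
  have "ereal 0 \<le> Liminf ?F ?k"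
    by (rule Liminf_bounded, rule eventually_mono[OF ev]) (use assms(2) kappa_at_bounds in auto)
  moreover have "Liminf ?F ?k \<le> Limsup ?F ?k"
    by (rule Liminf_le_Limsup[OF nt])
  moreover have "Limsup ?F ?k \<le> ereal (real d / 2)"
    by (rule Limsup_bounded, rule eventually_mono[OF ev]) (use assms(2) kappa_at_bounds in auto)
  ultimately show ?thesis
    by (cases "Liminf ?F ?k") (auto simp: kappa_def)
qed

end

theory Submission
  imports Defs
begin

text \<open>
  Write \<open>F\<close> for the Fourier transform and let \<open>g\<close> be supported on \<open>S\<close>. Because \<open>g = g 1\<^sub>S\<close>,
  Parseval's identity writes \<open>N\<^bsup>d/2\<^esup> Fg(\<xi>)\<close> as the inner product of \<open>Fg\<close> with a translate of \<open>F1\<^sub>S\<close>,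
  so Hoelder's inequality gives \<open>N\<^bsup>d/2\<^esup> \<parallel>Fg\<parallel>\<^sub>\<infinity> \<le> \<parallel>Fg\<parallel>\<^sub>p \<parallel>F1\<^sub>S\<parallel>\<^sub>q\<close> with \<open>1/p + 1/q = 1\<close>.
  Interpolating \<open>L\<^sup>q\<close> between \<open>L\<^sup>1\<close> and \<open>L\<^sup>2\<close> yields \<open>\<parallel>F1\<^sub>S\<parallel>\<^sub>q \<le> FR(1\<^sub>S)\<^bsup>1-2/p\<^esup> |S|\<^bsup>1/2\<^esup>\<close>, which is
  the bound with \<open>\<kappa>\<^sub>S\<close>, uniformly in \<open>g\<close>. Using the exponent 2 in place of \<open>p\<close> and interpolating
  \<open>L\<^sup>2\<close> between \<open>L\<^sup>1\<close> and \<open>L\<^sup>p\<close>, so that \<open>\<parallel>Fg\<parallel>\<^sub>2 \<le> FR(g)\<^bsup>1-2/p\<^esup> \<parallel>Fg\<parallel>\<^sub>p\<close>, gives the bound with \<open>\<kappa>\<^sub>f\<close>.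
  The decay claims hold because the exponent of \<open>N\<close> is negative in the stated ranges.
\<close>

section \<open>Hoelder's inequality and interpolation between norms\<close>

text \<open>After both sums are normalised to 1, this is Young's inequality applied termwise.
  Stating it with weights \<open>s\<close> and \<open>t\<close> instead of conjugate norms lets it
  serve Hoelder's inequality and both interpolations below. The endpoint weight 0 is allowed because
  the interpolations reach it at \<open>p = 2\<close>.\<close>

lemma weighted_Holder_sum:
  fixes u v :: "'a \<Rightarrow> real"
  assumes "finite A" "\<And>x. x \<in> A \<Longrightarrow> 0 \<le> u x" "\<And>x. x \<in> A \<Longrightarrow> 0 \<le> v x"
    and "0 \<le> s" "0 \<le> t" "s + t = 1"
  shows "(\<Sum>x\<in>A. u x powr s * v x powr t) \<le> (\<Sum>x\<in>A. u x) powr s * (\<Sum>x\<in>A. v x) powr t"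
proof -
  define U V where "U = (\<Sum>x\<in>A. u x)" and "V = (\<Sum>x\<in>A. v x)"
  have UV: "0 \<le> U" "0 \<le> V"
    using assms by (auto simp: U_def V_def intro: sum_nonneg)
  show ?thesis
  proof (cases "U = 0 \<or> V = 0")
    case True
    then have "\<forall>x\<in>A. u x = 0 \<or> v x = 0"
      using assms by (auto simp: U_def V_def sum_nonneg_eq_0_iff)
    \<comment> \<open>Since \<open>0 powr a = 0\<close> also for \<open>a = 0\<close>, each product
      vanishes even when one of the weights is 0.\<close>
    then have "(\<Sum>x\<in>A. u x powr s * v x powr t) = 0"
      by (intro sum.neutral) auto
    then show ?thesis
      by simp
  next
    case False
    then have pos: "U > 0" "V > 0"
      using UV by auto
    have "(\<Sum>x\<in>A. u x powr s * v x powr t)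
        = U powr s * V powr t * (\<Sum>x\<in>A. (u x / U) powr s * (v x / V) powr t)"
      using assms pos by (simp add: sum_distrib_left powr_divide)
    also have "\<dots> \<le> U powr s * V powr t * (\<Sum>x\<in>A. s * (u x / U) + t * (v x / V))"
    proof (intro mult_left_mono sum_mono)
      fix x assume x: "x \<in> A"
      show "(u x / U) powr s * (v x / V) powr t \<le> s * (u x / U) + t * (v x / V)"
      proof (cases "u x = 0 \<or> v x = 0")
        case True
        then show ?thesis
          using assms x pos by auto
      next
        case False
        then have "u x / U > 0" "v x / V > 0"
          using assms(2,3)[OF x] pos by auto
        then show ?thesis
          using Youngs_inequality_0 assms by blast
      qed
    qed simp
    also have "(\<Sum>x\<in>A. s * (u x / U) + t * (v x / V)) = s * (U / U) + t * (V / V)"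
      by (simp add: sum.distrib U_def V_def flip: sum_distrib_left sum_divide_distrib)
    also have "\<dots> = 1"
      using pos assms by simp
    finally show ?thesis
      by (simp add: U_def V_def)
  qed
qed

lemma lp_norm_nonneg: "0 \<le> lp_norm d N r f"
  by (simp add: lp_norm_def)

lemma powr_lp_norm: "r \<noteq> 0 \<Longrightarrow> lp_norm d N r f powr r = (\<Sum>x\<in>ZNd d N. norm (f x) powr r)"
  by (simp add: lp_norm_def powr_powr sum_nonneg)

lemma lp_norm_Holder:
  assumes "p > 1"
  shows "(\<Sum>x\<in>ZNd d N. norm (f x) * norm (g x)) \<le> lp_norm d N p f * lp_norm d N (p / (p - 1)) g"
proof -
  have "(\<Sum>x\<in>ZNd d N. norm (f x) * norm (g x))
      = (\<Sum>x\<in>ZNd d N. (norm (f x) powr p) powr (1 / p)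
          * (norm (g x) powr (p / (p - 1))) powr ((p - 1) / p))"
    using assms by (simp add: powr_powr)
  also have "\<dots> \<le> (\<Sum>x\<in>ZNd d N. norm (f x) powr p) powr (1 / p)
      * (\<Sum>x\<in>ZNd d N. norm (g x) powr (p / (p - 1))) powr ((p - 1) / p)"
    using assms by (intro weighted_Holder_sum) (auto simp: finite_ZNd field_simps)
  also have "\<dots> = lp_norm d N p f * lp_norm d N (p / (p - 1)) g"
    by (simp add: lp_norm_def)
  finally show ?thesis .
qed

text \<open>The exponent 2 is split as \<open>(p - 2) / (p - 1)\<close> times 1 plus
  \<open>1 / (p - 1)\<close> times \<open>p\<close>. The two weights sum to 1, so the weighted
  Hoelder inequality bounds the square of the 2-norm by the 1-norm and the
  \<open>p\<close>-norm.\<close>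

lemma lp_norm_2_interpolation:
  assumes "p \<ge> 2" "lp_norm d N 2 f > 0"
  shows "lp_norm d N 2 f \<le> (lp_norm d N 1 f / lp_norm d N 2 f) powr (1 - 2 / p) * lp_norm d N p f"
proof -
  define A B Q where "A = lp_norm d N 1 f" and "B = lp_norm d N 2 f"
    and "Q = lp_norm d N p f"
  have nn: "A \<ge> 0" "B > 0" "Q \<ge> 0"
    using assms by (simp_all add: A_def B_def Q_def lp_norm_nonneg)
  have "B powr 2 = (\<Sum>x\<in>ZNd d N. norm (f x) powr 2)"
    unfolding B_def by (rule powr_lp_norm) simp
  also have "\<dots> = (\<Sum>x\<in>ZNd d N. norm (f x) powr ((p - 2) / (p - 1))
      * (norm (f x) powr p) powr (1 / (p - 1)))"
  proof (rule sum.cong[OF refl])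
    fix x
    have "(p - 2) / (p - 1) + p / (p - 1) = 2"
      using assms by (simp add: divide_eq_eq flip: add_divide_distrib)
    then show "norm (f x) powr 2
        = norm (f x) powr ((p - 2) / (p - 1)) * (norm (f x) powr p) powr (1 / (p - 1))"
      by (simp add: powr_powr flip: powr_add)
  qed
  also have "\<dots> \<le> A powr ((p - 2) / (p - 1)) * (Q powr p) powr (1 / (p - 1))"
    unfolding A_def Q_def lp_norm_1 using assms
    by (subst powr_lp_norm) (auto intro!: weighted_Holder_sum simp: finite_ZNd field_simps)
  \<comment> \<open>The power \<open>(p - 1) / p\<close> gives \<open>Q\<close> the exponent 1 and
    \<open>A\<close> the exponent \<open>1 - 2 / p\<close>. On the left it gives \<open>B\<close>
    the exponent \<open>(1 - 2 / p) + 1\<close>, so that dividing by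
    \<open>B powr (1 - 2 / p)\<close> produces the ratio.\<close>
  finally have "(B powr 2) powr ((p - 1) / p)
      \<le> (A powr ((p - 2) / (p - 1)) * (Q powr p) powr (1 / (p - 1))) powr ((p - 1) / p)"
    using assms by (intro powr_mono2) auto
  also have "\<dots> = A powr (1 - 2 / p) * Q"
  proof -
    have "(p - 2) / (p - 1) * ((p - 1) / p) = 1 - 2 / p" "p * (1 / (p - 1)) * ((p - 1) / p) = 1"
      using assms by (simp_all add: divide_simps)
    then show ?thesis
      using nn by (simp only: powr_mult powr_ge_zero powr_powr powr_one)
  qed
  also have "(B powr 2) powr ((p - 1) / p) = B powr (1 - 2 / p) * B"
  proof -
    have "2 * ((p - 1) / p) = (1 - 2 / p) + 1"
      using assms by (simp add: field_simps)
    then show ?thesis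
      using nn by (simp only: powr_powr powr_add) simp
  qed
  finally have "B \<le> (A / B) powr (1 - 2 / p) * Q"
    using nn by (simp add: powr_divide field_simps)
  then show ?thesis
    by (simp add: A_def B_def Q_def)
qed

text \<open>The conjugate exponent \<open>q\<close> lies between 1 and 2, and
  \<open>q = (2 - q) * 1 + (q - 1) * 2\<close> splits it with weights that sum to 1. The resulting
  power of the ratio is \<open>2 / q - 1\<close>, which equals \<open>1 - 2 / p\<close>.\<close>

lemma lp_norm_conjugate_interpolation:
  assumes "p \<ge> 2" "lp_norm d N 2 f > 0"
  shows "lp_norm d N (p / (p - 1)) f
      \<le> (lp_norm d N 1 f / lp_norm d N 2 f) powr (1 - 2 / p) * lp_norm d N 2 f"
proof -
  define A B where "A = lp_norm d N 1 f" and "B = lp_norm d N 2 f"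
  define q where "q = p / (p - 1)"
  have nn: "A \<ge> 0" "B > 0"
    using assms by (simp_all add: A_def B_def lp_norm_nonneg)
  have q: "1 < q" "q \<le> 2" "2 / q - 1 = 1 - 2 / p"
    using assms by (simp_all add: q_def field_simps)
  have "(\<Sum>x\<in>ZNd d N. norm (f x) powr q)
      = (\<Sum>x\<in>ZNd d N. norm (f x) powr (2 - q) * (norm (f x) powr 2) powr (q - 1))"
  proof (rule sum.cong[OF refl])
    fix x
    have "(2 - q) + 2 * (q - 1) = q"
      by simp
    then show "norm (f x) powr q = norm (f x) powr (2 - q) * (norm (f x) powr 2) powr (q - 1)"
      by (simp only: powr_powr flip: powr_add)
  qed
  also have "\<dots> \<le> A powr (2 - q) * (B powr 2) powr (q - 1)"
    unfolding A_def B_def lp_norm_1 using q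
    by (subst powr_lp_norm) (auto intro!: weighted_Holder_sum simp: finite_ZNd)
  finally have "lp_norm d N q f \<le> (A powr (2 - q) * (B powr 2) powr (q - 1)) powr (1 / q)"
    unfolding lp_norm_def using q by (intro powr_mono2) (auto intro: sum_nonneg)
  also have "\<dots> = A powr (2 / q - 1) * B powr (1 - (2 / q - 1))"
  proof -
    have "(2 - q) * (1 / q) = 2 / q - 1" "2 * (q - 1) * (1 / q) = 1 - (2 / q - 1)"
      using q by (simp_all add: field_simps)
    then show ?thesis
      using nn by (simp only: powr_mult powr_ge_zero powr_powr mult.assoc)
  qed
  also have "\<dots> = (A / B) powr (1 - 2 / p) * B"
    using nn by (simp add: q(3) powr_diff powr_divide)
  finally show ?thesis
    by (simp add: A_def B_def q_def)
qed

section \<open>Roots of unity and characters\<close>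

text \<open>The negative sign is that of the Fourier kernel, so the kernel is a nonnegative power of
  this root.\<close>

definition root_of_unity :: "nat \<Rightarrow> complex" where
  "root_of_unity N = exp (- 2 * of_real pi * \<i> / of_nat N)"

lemma root_of_unity_power: "root_of_unity N ^ k = exp (- 2 * of_real pi * \<i> * of_nat k / of_nat N)"
  by (simp add: root_of_unity_def exp_of_nat_mult[symmetric] mult_ac)

lemma norm_root_of_unity [simp]: "norm (root_of_unity N) = 1"
  by (simp add: root_of_unity_def norm_exp_eq_Re)

lemma root_of_unity_nonzero [simp]: "root_of_unity N \<noteq> 0"
  by (simp add: root_of_unity_def)

lemma root_of_unity_power_self: "N > 0 \<Longrightarrow> root_of_unity N ^ N = 1"
  by (simp add: root_of_unity_power exp_minus mult_ac)

lemma cnj_root_of_unity: "cnj (root_of_unity N) = inverse (root_of_unity N)"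
  by (simp add: root_of_unity_def exp_cnj exp_minus[symmetric])

lemma root_of_unity_power_eq_iff:
  assumes "N > 0" "a < N" "b < N"
  shows "root_of_unity N ^ a = root_of_unity N ^ b \<longleftrightarrow> a = b"
proof -
  \<comment> \<open>\<open>complex_root_unity_eq\<close> concerns the root with the opposite sign in
    the exponent; inversion is injective and carries it over.\<close>
  have "root_of_unity N ^ k = inverse (exp (2 * of_real pi * \<i> * of_nat k / of_nat N))" for k
    by (simp add: root_of_unity_power exp_minus)
  then show ?thesis
    using complex_root_unity_eq[of N a b] assms by (simp add: cong_def)
qed

lemma root_of_unity_power_mod:
  assumes "N > 0"
  shows "root_of_unity N ^ (k mod N) = root_of_unity N ^ k"
proof -
  have "root_of_unity N ^ k = root_of_unity N ^ (N * (k div N) + k mod N)"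
    by simp
  then show ?thesis
    using assms by (simp only: power_add power_mult root_of_unity_power_self) simp
qed

text \<open>A geometric sum whose ratio \<open>z\<close> is an \<open>N\<close>-th root of unity,
  equal to 1 exactly when \<open>a = b\<close>. The conjugate avoids the truncated difference of
  \<open>a\<close> and \<open>b\<close>.\<close>

lemma sum_root_of_unity:
  assumes "N > 0" "a < N" "b < N"
  shows "(\<Sum>k<N. root_of_unity N ^ (a * k) * cnj (root_of_unity N) ^ (b * k))
      = (if a = b then of_nat N else 0)"
proof -
  define z where "z = root_of_unity N ^ a * inverse (root_of_unity N) ^ b"
  have eq: "(\<Sum>k<N. root_of_unity N ^ (a * k) * cnj (root_of_unity N) ^ (b * k)) = (\<Sum>k<N. z ^ k)"
    by (simp add: z_def cnj_root_of_unity power_mult power_mult_distrib)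
  show ?thesis
  proof (cases "a = b")
    case True
    then have "z = 1"
      by (simp add: z_def power_inverse)
    then show ?thesis
      unfolding eq using True by simp
  next
    case False
    then have "z \<noteq> 1"
      using root_of_unity_power_eq_iff[OF assms] by (simp add: z_def power_inverse field_simps)
    moreover have "z ^ N = 1"
    proof -
      have "z ^ N = (root_of_unity N ^ N) ^ a * inverse ((root_of_unity N ^ N) ^ b)"
        by (simp add: z_def power_mult_distrib power_inverse mult.commute flip: power_mult)
      then show ?thesis
        using assms by (simp add: root_of_unity_power_self)
    qed
    ultimately show ?thesis
      using False by (simp add: eq sum_gp_strict)
  qed
qed

definition character :: "nat \<Rightarrow> nat \<Rightarrow> (nat \<Rightarrow> nat) \<Rightarrow> (nat \<Rightarrow> nat) \<Rightarrow> complex" where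
  "character d N x \<xi> = root_of_unity N ^ (\<Sum>i<d. x i * \<xi> i)"

lemma fourier_eq_character:
  "fourier d N f \<xi> = of_real (real N powr (- (real d / 2))) * (\<Sum>x\<in>ZNd d N. f x * character d N x \<xi>)"
  by (simp add: fourier_def character_def root_of_unity_power)

lemma norm_character [simp]: "norm (character d N x \<xi>) = 1"
  by (simp add: character_def norm_power)

lemma character_mult_cnj: "character d N x \<xi> * cnj (character d N x \<xi>) = 1"
  by (simp add: complex_norm_square[symmetric])

text \<open>Characters factor over the coordinates, so the sum over the group is a product of
  one-dimensional sums, and one coordinate in which \<open>x\<close> and \<open>y\<close> differ
  makes it vanish.\<close>

lemma character_orthogonality:
  assumes "N > 0" "x \<in> ZNd d N" "y \<in> ZNd d N"
  shows "(\<Sum>\<xi>\<in>ZNd d N. character d N x \<xi> * cnj (character d N y \<xi>))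
      = (if x = y then of_nat N ^ d else 0)"
proof -
  have "(\<Sum>\<xi>\<in>ZNd d N. character d N x \<xi> * cnj (character d N y \<xi>))
      = (\<Sum>\<xi>\<in>{..<d} \<rightarrow>\<^sub>E {..<N}. \<Prod>i<d. root_of_unity N ^ (x i * \<xi> i) * cnj (root_of_unity N) ^ (y i * \<xi> i))"
    by (simp add: ZNd_def character_def power_sum prod.distrib)
  also have "\<dots> = (\<Prod>i<d. \<Sum>k<N. root_of_unity N ^ (x i * k) * cnj (root_of_unity N) ^ (y i * k))"
    by (simp add: prod_sum_PiE)
  also have "\<dots> = (\<Prod>i<d. if x i = y i then of_nat N else 0)"
    using assms by (intro prod.cong refl sum_root_of_unity) (auto simp: ZNd_def)
  also have "\<dots> = (if x = y then of_nat N ^ d else 0)"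
  proof (cases "x = y")
    case False
    \<comment> \<open>Elements of \<open>ZNd\<close> are extensional, so distinct ones differ at an
      index below \<open>d\<close>.\<close>
    then obtain i where "i < d" "x i \<noteq> y i"
      using assms(2,3) PiE_ext[of x "{..<d}" "\<lambda>_. {..<N}" y] by (auto simp: ZNd_def)
    then show ?thesis
      using False by (auto intro: prod_zero)
  qed simp
  finally show ?thesis .
qed

section \<open>Parseval's identity and 2-norms\<close>

text \<open>Expanding both transforms and summing over \<xi> first leaves only the diagonal
  \<open>x = y\<close>; the factor \<open>N ^ d\<close> from orthogonality cancels against the two
  normalising constants.\<close>

lemma parseval:
  assumes "N > 0"
  shows "(\<Sum>\<xi>\<in>ZNd d N. fourier d N f \<xi> * cnj (fourier d N g \<xi>)) = (\<Sum>x\<in>ZNd d N. f x * cnj (g x))"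
proof -
  define c :: complex where "c = of_real (real N powr (- (real d / 2)))"
  have c: "c * cnj c * of_nat N ^ d = 1"
  proof -
    have "c * cnj c * of_nat N ^ d = of_real (real N powr (- (real d / 2))
        * real N powr (- (real d / 2)) * real N ^ d)"
      by (simp add: c_def)
    also have "real N ^ d = real N powr real d"
      using assms by (simp add: powr_realpow)
    finally show ?thesis
      using assms by (simp flip: powr_add)
  qed
  have "(\<Sum>\<xi>\<in>ZNd d N. fourier d N f \<xi> * cnj (fourier d N g \<xi>))
      = (\<Sum>\<xi>\<in>ZNd d N. \<Sum>x\<in>ZNd d N. \<Sum>y\<in>ZNd d N.
          c * cnj c * (f x * cnj (g y)) * (character d N x \<xi> * cnj (character d N y \<xi>)))"
  proof (rule sum.cong[OF refl])
    fix \<xi>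
    have "fourier d N f \<xi> * cnj (fourier d N g \<xi>)
        = (\<Sum>x\<in>ZNd d N. c * (f x * character d N x \<xi>)) * (\<Sum>y\<in>ZNd d N. cnj (c * (g y * character d N y \<xi>)))"
      by (simp only: fourier_eq_character c_def[symmetric] sum_distrib_left cnj_sum)
    also have "\<dots> = (\<Sum>x\<in>ZNd d N. \<Sum>y\<in>ZNd d N.
        c * (f x * character d N x \<xi>) * cnj (c * (g y * character d N y \<xi>)))"
      by (rule sum_product)
    also have "\<dots> = (\<Sum>x\<in>ZNd d N. \<Sum>y\<in>ZNd d N.
          c * cnj c * (f x * cnj (g y)) * (character d N x \<xi> * cnj (character d N y \<xi>)))"
      by (simp only: complex_cnj_mult mult_ac)
    finally show "fourier d N f \<xi> * cnj (fourier d N g \<xi>) = (\<Sum>x\<in>ZNd d N. \<Sum>y\<in>ZNd d N.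
          c * cnj c * (f x * cnj (g y)) * (character d N x \<xi> * cnj (character d N y \<xi>)))" .
  qed
  also have "\<dots> = (\<Sum>x\<in>ZNd d N. \<Sum>y\<in>ZNd d N. \<Sum>\<xi>\<in>ZNd d N.
          c * cnj c * (f x * cnj (g y)) * (character d N x \<xi> * cnj (character d N y \<xi>)))"
    by (subst sum.swap, rule sum.cong[OF refl], rule sum.swap)
  also have "\<dots> = (\<Sum>x\<in>ZNd d N. \<Sum>y\<in>ZNd d N. if x = y then f x * cnj (g y) else 0)"
  proof (intro sum.cong refl)
    fix x y assume "x \<in> ZNd d N" "y \<in> ZNd d N"
    then show "(\<Sum>\<xi>\<in>ZNd d N. c * cnj c * (f x * cnj (g y)) * (character d N x \<xi> * cnj (character d N y \<xi>)))
        = (if x = y then f x * cnj (g y) else 0)"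
      using c by (simp add: sum_distrib_left[symmetric] character_orthogonality assms)
        (simp add: mult_ac)
  qed
  also have "\<dots> = (\<Sum>x\<in>ZNd d N. f x * cnj (g x))"
    by (simp add: finite_ZNd)
  finally show ?thesis .
qed

lemma plancherel:
  assumes "N > 0"
  shows "lp_norm d N 2 (fourier d N f) = lp_norm d N 2 f"
proof -
  have "of_real (\<Sum>x\<in>ZNd d N. (norm (g x))\<^sup>2) = (\<Sum>x\<in>ZNd d N. g x * cnj (g x))"
    for g :: "_ \<Rightarrow> complex"
    by (simp only: of_real_sum complex_norm_square)
  then have "complex_of_real (\<Sum>x\<in>ZNd d N. (norm (fourier d N f x))\<^sup>2)
      = of_real (\<Sum>x\<in>ZNd d N. (norm (f x))\<^sup>2)"
    using parseval[OF assms] by simp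
  then show ?thesis
    by (simp only: of_real_eq_iff lp_norm_2 L2_set_def)
qed

lemma lp_norm_2_pos:
  assumes "nonzero_on d N f"
  shows "lp_norm d N 2 f > 0"
proof -
  obtain x where "x \<in> ZNd d N" "f x \<noteq> 0"
    using assms by (auto simp: nonzero_on_def)
  then have "0 < (\<Sum>x\<in>ZNd d N. (norm (f x))\<^sup>2)"
    by (intro sum_pos2[of _ x]) (auto simp: finite_ZNd)
  then show ?thesis
    by (simp add: lp_norm_2 L2_set_def)
qed

lemma lp_norm_2_indicator:
  assumes "S \<subseteq> ZNd d N"
  shows "lp_norm d N 2 (indicator S) = sqrt (card S)"
proof -
  have "(\<Sum>x\<in>ZNd d N. (norm (indicator S x :: complex))\<^sup>2) = (\<Sum>x\<in>ZNd d N. if x \<in> S then 1 else 0)"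
    by (intro sum.cong) (auto simp: indicator_def)
  also have "\<dots> = card S"
    using assms by (simp add: finite_ZNd Int_absorb1 sum.If_cases)
  finally show ?thesis
    by (simp add: lp_norm_2 L2_set_def)
qed

section \<open>Translation in frequency and modulation\<close>

text \<open>Addition in the group. Reducing mod \<open>N\<close> and restricting to
  \<open>{..<d}\<close> return the sum to the representatives that make up
  \<open>ZNd\<close>.\<close>

definition translate :: "nat \<Rightarrow> nat \<Rightarrow> (nat \<Rightarrow> nat) \<Rightarrow> (nat \<Rightarrow> nat) \<Rightarrow> nat \<Rightarrow> nat" where
  "translate d N \<xi> \<eta> = (\<lambda>i\<in>{..<d}. (\<eta> i + \<xi> i) mod N)"

lemma mod_add_right_cancel_less:
  fixes a b c N :: nat
  assumes "(a + c) mod N = (b + c) mod N" "a < N" "b < N"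
  shows "a = b"
proof (rule ccontr)
  assume "a \<noteq> b"
  have "int (a + c) mod int N = int (b + c) mod int N"
    using assms(1) by (simp only: flip: zmod_int)
  then have "int N dvd int a - int b"
    by (simp add: mod_eq_dvd_iff)
  then show False
    using dvd_imp_le_int[of "int a - int b" "int N"] \<open>a \<noteq> b\<close> assms(2,3) by auto
qed

lemma bij_betw_translate:
  assumes "N > 0"
  shows "bij_betw (translate d N \<xi>) (ZNd d N) (ZNd d N)"
proof -
  have sub: "translate d N \<xi> ` ZNd d N \<subseteq> ZNd d N"
  proof (rule image_subsetI)
    show "translate d N \<xi> \<eta> \<in> ZNd d N" for \<eta>
      unfolding translate_def ZNd_def restrict_PiE_iff using assms by simp
  qed
  have inj: "inj_on (translate d N \<xi>) (ZNd d N)"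
  proof (rule inj_onI)
    fix a b assume ab: "a \<in> ZNd d N" "b \<in> ZNd d N" "translate d N \<xi> a = translate d N \<xi> b"
    show "a = b"
    proof (rule PiE_ext)
      show "a \<in> {..<d} \<rightarrow>\<^sub>E {..<N}" "b \<in> {..<d} \<rightarrow>\<^sub>E {..<N}"
        using ab by (simp_all add: ZNd_def)
    next
      fix i assume i: "i \<in> {..<d}"
      then have "(a i + \<xi> i) mod N = (b i + \<xi> i) mod N"
        using fun_cong[OF ab(3), of i] by (simp add: translate_def)
      moreover have "a i < N" "b i < N"
        using ab i by (auto simp: ZNd_def PiE_mem)
      ultimately show "a i = b i"
        by (rule mod_add_right_cancel_less)
    qed
  qed
  show ?thesis
    using inj endo_inj_surj[OF finite_ZNd sub inj] by (rule bij_betw_imageI)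
qed

text \<open>A power of \<open>root_of_unity N\<close> depends only on its exponent mod
  \<open>N\<close>, so the reduction inside \<open>translate\<close> can be undone.\<close>

lemma character_translate:
  assumes "N > 0"
  shows "character d N x (translate d N \<xi> \<eta>) = character d N x \<eta> * character d N x \<xi>"
proof -
  have "(\<Sum>i<d. x i * translate d N \<xi> \<eta> i) mod N = (\<Sum>i<d. x i * ((\<eta> i + \<xi> i) mod N) mod N) mod N"
    by (simp add: translate_def mod_sum_eq)
  also have "\<dots> = (\<Sum>i<d. x i * (\<eta> i + \<xi> i)) mod N"
    by (simp add: mod_mult_right_eq mod_sum_eq)
  also have "\<dots> = ((\<Sum>i<d. x i * \<eta> i) + (\<Sum>i<d. x i * \<xi> i)) mod N"
    by (simp add: distrib_left sum.distrib)
  finally show ?thesis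
    unfolding character_def power_add[symmetric] using root_of_unity_power_mod[OF assms] by metis
qed

text \<open>Modulating \<open>f\<close> only translates its transform, and a translation permutes
  \<open>ZNd\<close>. This makes the Hoelder bound below the same at every frequency.\<close>

lemma lp_norm_fourier_modulation:
  assumes "N > 0"
  shows "lp_norm d N r (fourier d N (\<lambda>x. f x * cnj (character d N x \<xi>))) = lp_norm d N r (fourier d N f)"
proof -
  let ?h = "\<lambda>x. f x * cnj (character d N x \<xi>)"
  have "fourier d N ?h (translate d N \<xi> \<eta>) = fourier d N f \<eta>" for \<eta>
  proof -
    have "?h x * character d N x (translate d N \<xi> \<eta>)
        = f x * character d N x \<eta> * (character d N x \<xi> * cnj (character d N x \<xi>))" for x
      by (simp only: character_translate[OF assms] mult_ac)
    then have "?h x * character d N x (translate d N \<xi> \<eta>) = f x * character d N x \<eta>" for x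
      by (simp only: character_mult_cnj mult_1_right)
    then show ?thesis
      by (simp only: fourier_eq_character)
  qed
  then have "(\<Sum>\<eta>\<in>ZNd d N. norm (fourier d N f \<eta>) powr r)
      = (\<Sum>\<eta>\<in>ZNd d N. norm (fourier d N ?h \<eta>) powr r)"
    using sum.reindex_bij_betw[OF bij_betw_translate[OF assms],
        of "\<lambda>\<eta>. norm (fourier d N ?h \<eta>) powr r" d \<xi>] by simp
  then show ?thesis
    by (simp add: lp_norm_def)
qed

section \<open>Bounds on the transform at a fixed modulus\<close>

text \<open>By Parseval the inner product is the sum of \<open>g\<close> times the indicator times
  the character; the support condition removes the indicator and leaves the sum that defines the
  transform.\<close>

lemma fourier_eq_inner_product:
  assumes "N > 0" "supported_on d N S g"
  shows "fourier d N g \<xi> = of_real (real N powr (- (real d / 2))) *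
    (\<Sum>\<eta>\<in>ZNd d N. fourier d N g \<eta> * cnj (fourier d N (\<lambda>x. indicator S x * cnj (character d N x \<xi>)) \<eta>))"
  unfolding parseval[OF assms(1)] fourier_eq_character[of d N g \<xi>]
  using assms(2) by (auto simp: supported_on_def indicator_def intro!: sum.cong)

lemma sup_norm_le:
  assumes "N > 0" "\<And>x. x \<in> ZNd d N \<Longrightarrow> norm (f x) \<le> B"
  shows "sup_norm d N f \<le> B"
proof -
  have "ZNd d N \<noteq> {}"
    using assms(1) card_ZNd[of d N] by force
  then show ?thesis
    unfolding sup_norm_def using assms(2) by (intro Max.boundedI) (auto simp: finite_ZNd)
qed

lemma sup_norm_nonneg:
  assumes "N > 0"
  shows "0 \<le> sup_norm d N f"
proof -
  obtain x where "x \<in> ZNd d N"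
    using assms card_ZNd[of d N] by force
  then have "norm (f x) \<le> sup_norm d N f"
    unfolding sup_norm_def by (intro Max_ge) (auto simp: finite_ZNd)
  then show ?thesis
    using norm_ge_zero order_trans by blast
qed

lemma sup_norm_fourier_le_conjugate:
  assumes "N > 0" "supported_on d N S g" "p > 1"
  shows "sup_norm d N (fourier d N g) \<le> real N powr (- (real d / 2))
      * (lp_norm d N p (fourier d N g) * lp_norm d N (p / (p - 1)) (fourier d N (indicator S)))"
proof (rule sup_norm_le[OF assms(1)])
  fix \<xi>
  let ?h = "\<lambda>x. indicator S x * cnj (character d N x \<xi>)"
  have "norm (fourier d N g \<xi>) = real N powr (- (real d / 2)) *
      norm (\<Sum>\<eta>\<in>ZNd d N. fourier d N g \<eta> * cnj (fourier d N ?h \<eta>))"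
    by (subst fourier_eq_inner_product[OF assms(1,2)]) (simp add: norm_mult)
  also have "\<dots> \<le> real N powr (- (real d / 2)) *
      (\<Sum>\<eta>\<in>ZNd d N. norm (fourier d N g \<eta>) * norm (fourier d N ?h \<eta>))"
    by (intro mult_left_mono sum_norm_le) (auto simp: norm_mult)
  also have "\<dots> \<le> real N powr (- (real d / 2)) *
      (lp_norm d N p (fourier d N g) * lp_norm d N (p / (p - 1)) (fourier d N ?h))"
    by (intro mult_left_mono lp_norm_Holder assms) auto
  finally show "norm (fourier d N g \<xi>) \<le> real N powr (- (real d / 2))
      * (lp_norm d N p (fourier d N g) * lp_norm d N (p / (p - 1)) (fourier d N (indicator S)))"
    by (simp add: lp_norm_fourier_modulation[OF assms(1)])
qed

lemma nonzero_on_indicator: "S \<subseteq> ZNd d N \<Longrightarrow> S \<noteq> {} \<Longrightarrow> nonzero_on d N (indicator S)"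
  by (auto simp: nonzero_on_def indicator_def)

lemma sup_norm_fourier_le_FR_support:
  assumes "N > 0" "S \<subseteq> ZNd d N" "S \<noteq> {}" "supported_on d N S g" "p \<ge> 2"
  shows "sup_norm d N (fourier d N g) \<le> real N powr (- (real d / 2)) * sqrt (card S)
      * FR d N (indicator S) powr (1 - 2 / p) * lp_norm d N p (fourier d N g)"
proof -
  have n2: "lp_norm d N 2 (fourier d N (indicator S)) = sqrt (card S)"
    using assms by (simp add: plancherel lp_norm_2_indicator)
  have "sup_norm d N (fourier d N g) \<le> real N powr (- (real d / 2))
      * (lp_norm d N p (fourier d N g) * lp_norm d N (p / (p - 1)) (fourier d N (indicator S)))"
    using assms by (intro sup_norm_fourier_le_conjugate) auto
  also have "\<dots> \<le> real N powr (- (real d / 2))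
      * (lp_norm d N p (fourier d N g) * (FR d N (indicator S) powr (1 - 2 / p) * sqrt (card S)))"
    unfolding n2[symmetric] FR_def using assms
    by (intro mult_left_mono lp_norm_conjugate_interpolation)
      (auto simp: lp_norm_nonneg plancherel intro!: lp_norm_2_pos nonzero_on_indicator)
  finally show ?thesis
    by (simp add: mult_ac)
qed

text \<open>Here the 2-norm of the transform of \<open>g\<close> is interpolated, rather than a norm
  of the transform of the indicator, so the ratio that appears is that of \<open>g\<close>.\<close>

lemma sup_norm_fourier_le_FR:
  assumes "N > 0" "S \<subseteq> ZNd d N" "supported_on d N S g" "nonzero_on d N g" "p \<ge> 2"
  shows "sup_norm d N (fourier d N g) \<le> real N powr (- (real d / 2)) * sqrt (card S)
      * FR d N g powr (1 - 2 / p) * lp_norm d N p (fourier d N g)"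
proof -
  have "sup_norm d N (fourier d N g) \<le> real N powr (- (real d / 2))
      * (lp_norm d N 2 (fourier d N g) * sqrt (card S))"
    \<comment> \<open>The exponent 2 is its own conjugate, so Plancherel evaluates the indicator
      factor as \<open>sqrt (card S)\<close>.\<close>
    using sup_norm_fourier_le_conjugate[of N d S g 2] assms
    by (simp add: plancherel lp_norm_2_indicator)
  also have "\<dots> \<le> real N powr (- (real d / 2))
      * (FR d N g powr (1 - 2 / p) * lp_norm d N p (fourier d N g) * sqrt (card S))"
    unfolding FR_def using assms
    by (intro mult_left_mono mult_right_mono lp_norm_2_interpolation)
      (auto simp: plancherel intro!: lp_norm_2_pos)
  finally show ?thesis
    by (simp add: mult_ac)
qed

section \<open>From fixed moduli to asymptotic bounds\<close>

lemma FR_eq_powr_kappa_at: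
  assumes "N \<ge> 2" "nonzero_on d N g"
  shows "FR d N g = real N powr (real d / 2 - kappa_at d N g)"
proof -
  have B: "lp_norm d N 2 (fourier d N g) > 0"
    using assms lp_norm_2_pos by (simp add: plancherel)
  have "lp_norm d N 2 (fourier d N g) \<le> lp_norm d N 1 (fourier d N g)"
    unfolding lp_norm_1 lp_norm_2 by (rule L2_set_le_sum) simp
  then have FR: "FR d N g > 0"
    using B by (simp add: FR_def)
  then have "ln (FR d N g) = (real d / 2 - kappa_at d N g) * ln (real N)"
    using assms by (simp add: kappa_at_def ln_div ln_powr field_simps)
  then show ?thesis
    using FR assms by (simp add: powr_def) (metis exp_ln)
qed

lemma eventually_in_moduli: "\<forall>\<^sub>F N in moduli_at_top M. N \<in> M"
  by (simp add: moduli_at_top_def eventually_inf_principal)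

lemma filterlim_moduli_at_top: "filterlim real at_top (moduli_at_top M)"
  unfolding moduli_at_top_def by (rule filterlim_mono[OF filterlim_real_sequentially]) auto

lemma eventually_kappa_at_gt:
  assumes "infinite M" "\<forall>N\<in>M. N \<ge> 2" "e > 0"
  shows "\<forall>\<^sub>F N in moduli_at_top M. kappa_at d N (h N) > kappa d M h - e"
proof -
  have "ereal (kappa d M h - e) < Liminf (moduli_at_top M) (\<lambda>N. ereal (kappa_at d N (h N)))"
    using assms by (simp flip: ereal_kappa)
  then show ?thesis
    using less_LiminfD by fastforce
qed

text \<open>A set \<open>G N\<close> for each modulus lets one predicate cover both the given
  sequence, with \<open>G N = {f N}\<close>, and the uniform claim: \<open>g\<close> is quantified
  inside the eventuality, so the threshold does not depend on it.\<close>

definition sup_bound :: "nat \<Rightarrow> nat set \<Rightarrow> real \<Rightarrow> (nat \<Rightarrow> ((nat \<Rightarrow> nat) \<Rightarrow> complex) set) \<Rightarrow> real \<Rightarrow> bool" where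
  "sup_bound d M \<alpha> G \<kappa> \<longleftrightarrow> (\<forall>p\<ge>2. \<forall>\<epsilon>>0. \<forall>\<^sub>F N in moduli_at_top M. \<forall>g\<in>G N.
     sup_norm d N (fourier d N g)
       \<le> real N powr ((\<alpha> - real d) / 2 + (real d / 2 - \<kappa>) * (1 - 2 / p) + \<epsilon>)
          * lp_norm d N p (fourier d N g))"

text \<open>The function \<open>h N\<close> whose ratio enters the bound is kept apart from the
  functions \<open>g\<close> being bounded, so that both the indicators and the sequence
  \<open>f\<close> can play its part.\<close>

lemma sup_bound_kappa:
  assumes inf: "infinite M" and ge2: "\<forall>N\<in>M. N \<ge> 2"
    and S: "((\<lambda>N. ln (real (card (S N))) / ln (real N)) \<longlongrightarrow> \<alpha>) (moduli_at_top M)"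
    and S': "\<forall>N\<in>M. S N \<subseteq> ZNd d N \<and> S N \<noteq> {}"
    and h: "\<forall>N\<in>M. nonzero_on d N (h N)"
    and G: "\<And>N g p. N \<in> M \<Longrightarrow> g \<in> G N \<Longrightarrow> p \<ge> 2 \<Longrightarrow>
      sup_norm d N (fourier d N g) \<le> real N powr (- (real d / 2)) * sqrt (card (S N))
        * FR d N (h N) powr (1 - 2 / p) * lp_norm d N p (fourier d N g)"
  shows "sup_bound d M \<alpha> G (kappa d M h)"
  unfolding sup_bound_def
proof (intro allI impI)
  fix p \<epsilon> :: real assume p: "p \<ge> 2" and \<epsilon>: "\<epsilon> > 0"
  \<comment> \<open>An error \<epsilon> here costs only half of \<epsilon> after the square root of
    the cardinality; the other half is spent on \<open>kappa\<close>, where the factor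
    \<open>1 - 2 / p\<close> is at most 1.\<close>
  have "\<forall>\<^sub>F N in moduli_at_top M. ln (real (card (S N))) / ln (real N) < \<alpha> + \<epsilon>"
    using order_tendstoD(2)[OF S, of "\<alpha> + \<epsilon>"] \<epsilon> by simp
  moreover have "\<forall>\<^sub>F N in moduli_at_top M. kappa_at d N (h N) > kappa d M h - \<epsilon> / 2"
    using inf ge2 \<epsilon> by (intro eventually_kappa_at_gt) auto
  ultimately show "\<forall>\<^sub>F N in moduli_at_top M. \<forall>g\<in>G N. sup_norm d N (fourier d N g)
      \<le> real N powr ((\<alpha> - real d) / 2 + (real d / 2 - kappa d M h) * (1 - 2 / p) + \<epsilon>)
        * lp_norm d N p (fourier d N g)"
    using eventually_in_moduli[of M]
  proof eventually_elim
    case (elim N)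
    have N: "N \<ge> 2" and lnN: "ln (real N) > 0"
      using elim ge2 by auto
    have "card (S N) > 0"
      using elim S' finite_ZNd by (metis card_gt_0_iff finite_subset)
    then have "sqrt (card (S N)) = real N powr (ln (card (S N)) / ln N / 2)"
      using N lnN by (simp add: powr_def powr_half_sqrt[symmetric] mult.commute)
    also have "\<dots> \<le> real N powr (\<alpha> / 2 + \<epsilon> / 2)"
      using N elim by (intro powr_mono) auto
    finally have 1: "sqrt (card (S N)) \<le> real N powr (\<alpha> / 2 + \<epsilon> / 2)" .
    have "FR d N (h N) powr (1 - 2 / p)
        = real N powr ((real d / 2 - kappa_at d N (h N)) * (1 - 2 / p))"
      using N h elim by (simp add: FR_eq_powr_kappa_at powr_powr)
    also have "\<dots> \<le> real N powr ((real d / 2 - kappa d M h) * (1 - 2 / p) + \<epsilon> / 2)"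
    proof (intro powr_mono)
      have "(real d / 2 - kappa_at d N (h N)) * (1 - 2 / p)
          \<le> (real d / 2 - kappa d M h + \<epsilon> / 2) * (1 - 2 / p)"
        using p elim by (intro mult_right_mono) (auto simp: field_simps)
      also have "\<dots> \<le> (real d / 2 - kappa d M h) * (1 - 2 / p) + \<epsilon> / 2"
        using p \<epsilon> by (simp add: field_simps)
      finally show "(real d / 2 - kappa_at d N (h N)) * (1 - 2 / p)
          \<le> (real d / 2 - kappa d M h) * (1 - 2 / p) + \<epsilon> / 2" .
    qed (use N in auto)
    finally have 2: "FR d N (h N) powr (1 - 2 / p)
        \<le> real N powr ((real d / 2 - kappa d M h) * (1 - 2 / p) + \<epsilon> / 2)" .
    have "real N powr (- (real d / 2)) * sqrt (card (S N)) * FR d N (h N) powr (1 - 2 / p)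
      \<le> real N powr (- (real d / 2)) * real N powr (\<alpha> / 2 + \<epsilon> / 2)
        * real N powr ((real d / 2 - kappa d M h) * (1 - 2 / p) + \<epsilon> / 2)"
      by (intro mult_mono 1 2) auto
    also have "\<dots> = real N powr ((\<alpha> - real d) / 2 + (real d / 2 - kappa d M h) * (1 - 2 / p) + \<epsilon>)"
      unfolding powr_add[symmetric] by (rule arg_cong[of _ _ "(powr) (real N)"]) argo
    finally have "real N powr (- (real d / 2)) * sqrt (card (S N)) * FR d N (h N) powr (1 - 2 / p)
      \<le> real N powr ((\<alpha> - real d) / 2 + (real d / 2 - kappa d M h) * (1 - 2 / p) + \<epsilon>)" .
    then show ?case
      using G[OF elim(3) _ p] by (meson lp_norm_nonneg mult_right_mono order_trans)
  qed
qed

text \<open>Half of the negative exponent \<open>e\<close> is given up as \<epsilon>, and the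
  remaining negative power of \<open>N\<close> times \<open>C\<close> still tends to 0.\<close>

lemma sup_bound_decay:
  assumes "sup_bound d M \<alpha> G \<kappa>" "p \<ge> 2" "(\<alpha> - real d) / 2 + (real d / 2 - \<kappa>) * (1 - 2 / p) < 0" "\<delta> > 0"
  shows "\<forall>\<^sub>F N in moduli_at_top M. \<forall>g\<in>G N.
    lp_norm d N p (fourier d N g) \<le> C \<longrightarrow> sup_norm d N (fourier d N g) < \<delta>"
proof -
  define e where "e = (\<alpha> - real d) / 2 + (real d / 2 - \<kappa>) * (1 - 2 / p)"
  define \<epsilon> where "\<epsilon> = - e / 2"
  have \<epsilon>: "\<epsilon> > 0" "e + \<epsilon> = - \<epsilon>"
    using assms(3) by (simp_all add: \<epsilon>_def flip: e_def)
  have "((\<lambda>N. real N powr (- \<epsilon>) * C) \<longlongrightarrow> 0) (moduli_at_top M)"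
    using \<epsilon> by (intro tendsto_mult_left_zero tendsto_neg_powr filterlim_moduli_at_top) auto
  then have "\<forall>\<^sub>F N in moduli_at_top M. real N powr (- \<epsilon>) * C < \<delta>"
    using assms(4) by (rule order_tendstoD)
  moreover have "\<forall>\<^sub>F N in moduli_at_top M. \<forall>g\<in>G N.
      sup_norm d N (fourier d N g) \<le> real N powr (e + \<epsilon>) * lp_norm d N p (fourier d N g)"
    using assms(1,2) \<epsilon>(1) unfolding sup_bound_def e_def by blast
  ultimately show ?thesis
  proof eventually_elim
    case (elim N)
    show ?case
    proof (intro ballI impI)
      fix g assume g: "g \<in> G N" "lp_norm d N p (fourier d N g) \<le> C"
      have "sup_norm d N (fourier d N g) \<le> real N powr (- \<epsilon>) * lp_norm d N p (fourier d N g)"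
        using elim(2) g(1) \<epsilon>(2) by auto
      also have "\<dots> \<le> real N powr (- \<epsilon>) * C"
        using g(2) by (intro mult_left_mono) auto
      finally show "sup_norm d N (fourier d N g) < \<delta>"
        using elim(1) by simp
    qed
  qed
qed

text \<open>Multiplied by \<open>2 * p\<close>, the exponent becomes
  \<open>p * (\<alpha> - 2 * \<kappa>) - 2 * (real d - 2 * \<kappa>)\<close>, whose sign is governed
  by the threshold on \<open>p\<close>.\<close>

lemma sup_bound_decay_below:
  assumes "sup_bound d M \<alpha> G \<kappa>" "\<kappa> < \<alpha> / 2" "2 \<le> p" "p < 2 * (real d - 2 * \<kappa>) / (\<alpha> - 2 * \<kappa>)" "\<delta> > 0"
  shows "\<forall>\<^sub>F N in moduli_at_top M. \<forall>g\<in>G N.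
    lp_norm d N p (fourier d N g) \<le> C \<longrightarrow> sup_norm d N (fourier d N g) < \<delta>"
proof (rule sup_bound_decay[OF assms(1,3) _ assms(5)])
  have "p * (\<alpha> - 2 * \<kappa>) < 2 * (real d - 2 * \<kappa>)"
    using assms by (simp add: field_simps)
  then show "(\<alpha> - real d) / 2 + (real d / 2 - \<kappa>) * (1 - 2 / p) < 0"
    using assms(3) by (simp add: field_simps)
qed

text \<open>At the critical value the exponent equals \<open>(\<alpha> - real d) / p\<close>, which
  is negative for every \<open>p\<close> in the range.\<close>

lemma sup_bound_decay_critical:
  assumes "sup_bound d M \<alpha> G \<kappa>" "\<kappa> = \<alpha> / 2" "\<alpha> < real d" "2 \<le> p" "\<delta> > 0"
  shows "\<forall>\<^sub>F N in moduli_at_top M. \<forall>g\<in>G N.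
    lp_norm d N p (fourier d N g) \<le> C \<longrightarrow> sup_norm d N (fourier d N g) < \<delta>"
proof (rule sup_bound_decay[OF assms(1,4) _ assms(5)])
  show "(\<alpha> - real d) / 2 + (real d / 2 - \<kappa>) * (1 - 2 / p) < 0"
    using assms(2-4) by (simp add: field_simps)
qed

lemma tendsto_zero_of_decay:
  assumes ge2: "\<forall>N\<in>M. N \<ge> 2"
    and decay: "\<And>C \<delta>. \<delta> > 0 \<Longrightarrow> \<forall>\<^sub>F N in moduli_at_top M. \<forall>g\<in>{f N}.
      lp_norm d N p (fourier d N g) \<le> C \<longrightarrow> sup_norm d N (fourier d N g) < \<delta>"
    and bdd: "bdd_above ((\<lambda>N. lp_norm d N p (fourier d N (f N))) ` M)"
  shows "((\<lambda>N. sup_norm d N (fourier d N (f N))) \<longlongrightarrow> 0) (moduli_at_top M)"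
proof (rule tendstoI)
  fix \<delta> :: real assume "\<delta> > 0"
  obtain C where C: "\<And>N. N \<in> M \<Longrightarrow> lp_norm d N p (fourier d N (f N)) \<le> C"
    using bdd by (auto simp: bdd_above_def)
  from decay[OF \<open>\<delta> > 0\<close>, of C] eventually_in_moduli[of M]
  show "\<forall>\<^sub>F N in moduli_at_top M. dist (sup_norm d N (fourier d N (f N))) 0 < \<delta>"
  proof eventually_elim
    case (elim N)
    then have "N > 0"
      using ge2 by force
    then show ?case
      using elim C[OF elim(2)] sup_norm_nonneg[of N d "fourier d N (f N)"] by simp
  qed
qed

theorem theorem3p2:
  fixes d :: nat and M :: "nat set" and \<alpha> :: real
    and S :: "nat \<Rightarrow> (nat \<Rightarrow> nat) set"
    and f :: "nat \<Rightarrow> (nat \<Rightarrow> nat) \<Rightarrow> complex"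
    and \<kappa>f \<kappa>S :: real
  assumes "d \<ge> 1"
    and "infinite M" and "\<forall>N\<in>M. N \<ge> 2"
    and "\<forall>N\<in>M. S N \<subseteq> ZNd d N \<and> S N \<noteq> {}"
    and "((\<lambda>N. ln (real (card (S N))) / ln (real N)) \<longlongrightarrow> \<alpha>) (moduli_at_top M)"
    and "0 < \<alpha>" and "\<alpha> < real d"
    and "\<forall>N\<in>M. nonzero_on d N (f N) \<and> supported_on d N (S N) (f N)"
  defines "\<kappa>f \<equiv> kappa d M f"
    and "\<kappa>S \<equiv> kappa d M (\<lambda>N. indicator (S N))"
  shows "(\<forall>\<kappa>\<in>{max \<kappa>f \<kappa>S, \<kappa>f, \<kappa>S}.
        (\<forall>p\<ge>2. \<forall>\<epsilon>>0. \<forall>\<^sub>F N in moduli_at_top M.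
            sup_norm d N (fourier d N (f N))
              \<le> real N powr ((\<alpha> - real d) / 2 + (real d / 2 - \<kappa>) * (1 - 2 / p) + \<epsilon>)
                 * lp_norm d N p (fourier d N (f N)))
      \<and> (\<kappa> < \<alpha> / 2 \<longrightarrow>
          (\<forall>p. 2 \<le> p \<and> p < 2 * (real d - 2 * \<kappa>) / (\<alpha> - 2 * \<kappa>) \<longrightarrow>
            bdd_above ((\<lambda>N. lp_norm d N p (fourier d N (f N))) ` M) \<longrightarrow>
            ((\<lambda>N. sup_norm d N (fourier d N (f N))) \<longlongrightarrow> 0) (moduli_at_top M)))
      \<and> (\<kappa> = \<alpha> / 2 \<longrightarrow>
          (\<forall>p\<ge>2. bdd_above ((\<lambda>N. lp_norm d N p (fourier d N (f N))) ` M) \<longrightarrow>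
            ((\<lambda>N. sup_norm d N (fourier d N (f N))) \<longlongrightarrow> 0) (moduli_at_top M))))
    \<and> (\<forall>p\<ge>2. \<forall>\<epsilon>>0. \<forall>\<^sub>F N in moduli_at_top M. \<forall>g. supported_on d N (S N) g \<longrightarrow>
          sup_norm d N (fourier d N g)
            \<le> real N powr ((\<alpha> - real d) / 2 + (real d / 2 - \<kappa>S) * (1 - 2 / p) + \<epsilon>)
               * lp_norm d N p (fourier d N g))
    \<and> (\<kappa>S < \<alpha> / 2 \<longrightarrow>
        (\<forall>p. 2 \<le> p \<and> p < 2 * (real d - 2 * \<kappa>S) / (\<alpha> - 2 * \<kappa>S) \<longrightarrow>
          (\<forall>C. \<forall>\<delta>>0. \<forall>\<^sub>F N in moduli_at_top M. \<forall>g. supported_on d N (S N) g \<longrightarrow>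
            lp_norm d N p (fourier d N g) \<le> C \<longrightarrow> sup_norm d N (fourier d N g) < \<delta>)))
    \<and> (\<kappa>S = \<alpha> / 2 \<longrightarrow>
        (\<forall>p\<ge>2. \<forall>C. \<forall>\<delta>>0. \<forall>\<^sub>F N in moduli_at_top M. \<forall>g. supported_on d N (S N) g \<longrightarrow>
            lp_norm d N p (fourier d N g) \<le> C \<longrightarrow> sup_norm d N (fourier d N g) < \<delta>))"
proof -
  note ctx = assms(2,3,5,4)
  let ?G = "\<lambda>N. {g. supported_on d N (S N) g}"
  have bS: "sup_bound d M \<alpha> ?G \<kappa>S"
    unfolding \<kappa>S_def
  proof (rule sup_bound_kappa[OF ctx])
    show "\<forall>N\<in>M. nonzero_on d N (indicator (S N))"
      using assms(4) nonzero_on_indicator by blast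
    show "sup_norm d N (fourier d N g) \<le> real N powr (- (real d / 2)) * sqrt (card (S N))
        * FR d N (indicator (S N)) powr (1 - 2 / p) * lp_norm d N p (fourier d N g)"
      if "N \<in> M" "g \<in> {g. supported_on d N (S N) g}" "p \<ge> 2" for N g p
      using that assms(3,4) by (intro sup_norm_fourier_le_FR_support) force+
  qed
  have bf: "sup_bound d M \<alpha> (\<lambda>N. {f N}) \<kappa>f"
    unfolding \<kappa>f_def
  proof (rule sup_bound_kappa[OF ctx])
    show "\<forall>N\<in>M. nonzero_on d N (f N)"
      using assms(8) by blast
    show "sup_norm d N (fourier d N g) \<le> real N powr (- (real d / 2)) * sqrt (card (S N))
        * FR d N (f N) powr (1 - 2 / p) * lp_norm d N p (fourier d N g)"
      if "N \<in> M" "g \<in> {f N}" "p \<ge> 2" for N g p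
      using that assms(3,4,8) by (auto intro!: sup_norm_fourier_le_FR)
  qed
  \<comment> \<open>The uniform bound is specialised to \<open>f N\<close>, which is known to lie in
    \<open>?G N\<close> only for \<open>N\<close> in \<open>M\<close>; hence the appeal to
    \<open>eventually_in_moduli\<close>.\<close>
  have bfS: "sup_bound d M \<alpha> (\<lambda>N. {f N}) \<kappa>S"
    unfolding sup_bound_def
  proof (intro allI impI)
    fix p \<epsilon> :: real assume "p \<ge> 2" "\<epsilon> > 0"
    with bS have "\<forall>\<^sub>F N in moduli_at_top M. \<forall>g\<in>?G N. sup_norm d N (fourier d N g)
       \<le> real N powr ((\<alpha> - real d) / 2 + (real d / 2 - \<kappa>S) * (1 - 2 / p) + \<epsilon>)
          * lp_norm d N p (fourier d N g)"
      unfolding sup_bound_def by blast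
    with eventually_in_moduli[of M] show "\<forall>\<^sub>F N in moduli_at_top M. \<forall>g\<in>{f N}. sup_norm d N (fourier d N g)
       \<le> real N powr ((\<alpha> - real d) / 2 + (real d / 2 - \<kappa>S) * (1 - 2 / p) + \<epsilon>)
          * lp_norm d N p (fourier d N g)"
      by eventually_elim (use assms(8) in auto)
  qed
  \<comment> \<open>The maximum is one of the two values, so its bound is one of those already
    proved.\<close>
  have b: "sup_bound d M \<alpha> (\<lambda>N. {f N}) \<kappa>" if "\<kappa> \<in> {max \<kappa>f \<kappa>S, \<kappa>f, \<kappa>S}" for \<kappa>
    using that bf bfS by (auto simp: max_def)
  note tends = tendsto_zero_of_decay[OF assms(3)]
  show ?thesis
  proof (intro conjI ballI)
    fix \<kappa> assume "\<kappa> \<in> {max \<kappa>f \<kappa>S, \<kappa>f, \<kappa>S}"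
    note b = b[OF this]
    show "\<forall>p\<ge>2. \<forall>\<epsilon>>0. \<forall>\<^sub>F N in moduli_at_top M. sup_norm d N (fourier d N (f N))
        \<le> real N powr ((\<alpha> - real d) / 2 + (real d / 2 - \<kappa>) * (1 - 2 / p) + \<epsilon>)
          * lp_norm d N p (fourier d N (f N))"
      using b by (simp add: sup_bound_def)
    show "\<kappa> < \<alpha> / 2 \<longrightarrow> (\<forall>p. 2 \<le> p \<and> p < 2 * (real d - 2 * \<kappa>) / (\<alpha> - 2 * \<kappa>) \<longrightarrow>
        bdd_above ((\<lambda>N. lp_norm d N p (fourier d N (f N))) ` M) \<longrightarrow>
        ((\<lambda>N. sup_norm d N (fourier d N (f N))) \<longlongrightarrow> 0) (moduli_at_top M))"
      using tends sup_bound_decay_below[OF b] by blast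
    show "\<kappa> = \<alpha> / 2 \<longrightarrow> (\<forall>p\<ge>2. bdd_above ((\<lambda>N. lp_norm d N p (fourier d N (f N))) ` M) \<longrightarrow>
        ((\<lambda>N. sup_norm d N (fourier d N (f N))) \<longlongrightarrow> 0) (moduli_at_top M))"
      using tends sup_bound_decay_critical[OF b _ assms(7)] by blast
  next
    show "\<forall>p\<ge>2. \<forall>\<epsilon>>0. \<forall>\<^sub>F N in moduli_at_top M. \<forall>g. supported_on d N (S N) g \<longrightarrow>
        sup_norm d N (fourier d N g)
          \<le> real N powr ((\<alpha> - real d) / 2 + (real d / 2 - \<kappa>S) * (1 - 2 / p) + \<epsilon>)
             * lp_norm d N p (fourier d N g)"
      using bS by (simp add: sup_bound_def)
    show "\<kappa>S < \<alpha> / 2 \<longrightarrow> (\<forall>p. 2 \<le> p \<and> p < 2 * (real d - 2 * \<kappa>S) / (\<alpha> - 2 * \<kappa>S) \<longrightarrow>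
        (\<forall>C. \<forall>\<delta>>0. \<forall>\<^sub>F N in moduli_at_top M. \<forall>g. supported_on d N (S N) g \<longrightarrow>
          lp_norm d N p (fourier d N g) \<le> C \<longrightarrow> sup_norm d N (fourier d N g) < \<delta>))"
      using sup_bound_decay_below[OF bS] by simp
    show "\<kappa>S = \<alpha> / 2 \<longrightarrow> (\<forall>p\<ge>2. \<forall>C. \<forall>\<delta>>0. \<forall>\<^sub>F N in moduli_at_top M. \<forall>g.
        supported_on d N (S N) g \<longrightarrow>
          lp_norm d N p (fourier d N g) \<le> C \<longrightarrow> sup_norm d N (fourier d N g) < \<delta>)"
      using sup_bound_decay_critical[OF bS _ assms(7)] by simp
  qed
qed

end
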